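(* For every natural number $k\geq 1$, $(\mathfrak{e}^{\mathrm{G}}_k)_{0}=\mathfrak{e}^{\mathrm{G}}_k$.
   Context: Let $Z\subseteq\omega^\omega$ denote the set of all eventually zero functions, i.e. those $f\in\omega^\omega$ with $f(n)=0$ for all but finitely many $n$. Let $\omega^{<\omega}$ be the set of finite sequences of natural numbers and $[\omega]^k$ the set of $k$-element subsets of $\omega$. For a natural number $k\ge 1$, a global predictor of width $k$ is a function $\pi\colon\omega^{<\omega}\to[\omega]^k$. Such a $\pi$ globally predicts $f\in\omega^\omega$ if $f(n)\in\pi(f\upharpoonright n)$ for all but finitely many $n\in\omega$. A global predictor $\pi$ of width $k$ $0$-globally predicts $f\in\omega^\omega$ if either $f\notin Z$ and $\pi$ globally predicts $f$, or $f\in Z$ and $\pi$ does not globally predict $f$. $\mathfrak{e}^{\mathrm{G}}_k$ is the least cardinality of a family $F\subseteq\omega^\omega$ such that no single global predictor of width $k$ globally predicts all members of $F$. $(\mathfrak{e}^{\mathrm{G}}_k)_{0}$ is the least cardinality of a family $F\subseteq\omega^\omega$ such that no single global predictor of width $k$ $0$-globally predicts all members of $F$. *)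

theory Defs
  imports Main
begin

unbundle cardinal_syntax

definition eventually_zero :: "(nat \<Rightarrow> nat) set" where
  "eventually_zero = {f. \<forall>\<^sub>\<infinity>n. f n = 0}"

definition global_predictor :: "nat \<Rightarrow> (nat list \<Rightarrow> nat set) \<Rightarrow> bool" where
  "global_predictor k \<pi> \<longleftrightarrow> (\<forall>s. finite (\<pi> s) \<and> card (\<pi> s) = k)"

(* The restriction of f to {0, ..., n - 1} is the list map f [0..<n]. *)
definition globally_predicts :: "(nat list \<Rightarrow> nat set) \<Rightarrow> (nat \<Rightarrow> nat) \<Rightarrow> bool" where
  "globally_predicts \<pi> f \<longleftrightarrow> (\<forall>\<^sub>\<infinity>n. f n \<in> \<pi> (map f [0..<n]))"

definition zero_globally_predicts :: "(nat list \<Rightarrow> nat set) \<Rightarrow> (nat \<Rightarrow> nat) \<Rightarrow> bool" where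
  "zero_globally_predicts \<pi> f \<longleftrightarrow>
     f \<notin> eventually_zero \<and> globally_predicts \<pi> f \<or>
     f \<in> eventually_zero \<and> \<not> globally_predicts \<pi> f"

(* A cardinal is a cardinal order of the library, determined only up to =o. For an
   empty collection the value is unspecified; least_card_unique shows that otherwise
   the choice of the family does not matter. *)
definition least_card :: "'a set set \<Rightarrow> 'a rel" where
  "least_card \<F> = |SOME F. F \<in> \<F> \<and> (\<forall>G\<in>\<F>. |F| \<le>o |G| )|"

definition eG :: "nat \<Rightarrow> (nat \<Rightarrow> nat) rel" where
  "eG k = least_card {F. \<not> (\<exists>\<pi>. global_predictor k \<pi> \<and> (\<forall>f\<in>F. globally_predicts \<pi> f))}"

definition eG_zero :: "nat \<Rightarrow> (nat \<Rightarrow> nat) rel" where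
  "eG_zero k = least_card {F. \<not> (\<exists>\<pi>. global_predictor k \<pi> \<and> (\<forall>f\<in>F. zero_globally_predicts \<pi> f))}"

lemma least_card_attained:
  assumes "\<F> \<noteq> {}"
  shows "\<exists>F\<in>\<F>. least_card \<F> = |F| \<and> (\<forall>G\<in>\<F>. |F| \<le>o |G| )"
proof -
  have "\<exists>r\<in>card_of ` \<F>. \<forall>r'\<in>card_of ` \<F>. r \<le>o r'"
    using assms by (intro exists_minim_Card_order) (auto simp: card_of_Card_order)
  then have "\<exists>F. F \<in> \<F> \<and> (\<forall>G\<in>\<F>. |F| \<le>o |G| )"
    by auto
  from someI_ex[OF this] show ?thesis
    unfolding least_card_def by blast
qed

lemma least_card_unique:
  assumes "F \<in> \<F>" and "\<And>G. G \<in> \<F> \<Longrightarrow> |F| \<le>o |G|"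
  shows "least_card \<F> =o |F|"
  using least_card_attained[of \<F>] assms by (metis empty_iff ordIso_iff_ordLeq)

(* Every predictor is evaded by some function that is nowhere zero, so both
   cardinals range over nonempty collections of families. *)
lemma evading_function:
  assumes "global_predictor k \<pi>"
  obtains f where "\<not> globally_predicts \<pi> f" and "f \<notin> eventually_zero"
proof -
  define x where "x s = (SOME m. m \<notin> insert 0 (\<pi> s))" for s
  have x: "x s \<notin> insert 0 (\<pi> s)" for s
  proof -
    have "finite (insert 0 (\<pi> s))"
      using assms by (simp add: global_predictor_def)
    then have "\<exists>m. m \<notin> insert 0 (\<pi> s)"
      using ex_new_if_finite infinite_UNIV_nat by blast
    then show ?thesis
      unfolding x_def by (rule someI_ex)
  qed
  define s where "s n = rec_nat [] (\<lambda>_ t. t @ [x t]) n" for n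
  define f where "f n = x (s n)" for n
  have "map f [0..<n] = s n" for n
    by (induction n) (simp_all add: s_def f_def)
  then have "f n \<notin> \<pi> (map f [0..<n])" "f n \<noteq> 0" for n
    using x[of "s n"] by (auto simp: f_def)
  then have "\<not> globally_predicts \<pi> f" "f \<notin> eventually_zero"
    by (simp_all add: globally_predicts_def eventually_zero_def eventually_cofinite)
  then show thesis
    by (rule that)
qed

lemma eG_family_exists:
  "\<not> (\<exists>\<pi>. global_predictor k \<pi> \<and> (\<forall>f\<in>UNIV. globally_predicts \<pi> f))"
  using evading_function by blast

lemma eG_zero_family_exists:
  "\<not> (\<exists>\<pi>. global_predictor k \<pi> \<and> (\<forall>f\<in>UNIV. zero_globally_predicts \<pi> f))"
  using evading_function unfolding zero_globally_predicts_def by blast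

end

theory Submission
  imports Defs "HOL-Library.Infinite_Set" "HOL-Library.Nat_Bijection"
begin

text \<open>
  Each of the two cardinals is bounded by the other through a map on functions that is compatible
  with prediction. For \<open>eG_zero k \<le> eG k\<close>, the map \<open>f \<mapsto> f + 1\<close> leaves \<open>Z\<close>, where
  0-global and global prediction agree. For \<open>eG k \<le> eG_zero k\<close>, a function \<open>f \<notin> Z\<close> is replaced by the
  function whose value at \<open>i\<close> codes the initial segment of \<open>f\<close> up to its first nonzero value at or
  after \<open>i\<close>. A predictor of these codes, applied after the last nonzero value seen so far, offers
  finitely many segments, one of which is right. Beyond the lengths of these segments only nonzero
  values are guessed, so a function that stays zero from there on is not predicted.
\<close>

text \<open>A family of least size in \<open>\<F>\<close> exists by nonemptiness, and it dominates
  some member of \<open>\<G>\<close>. Each inequality thus reduces to turning every unpredictable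
  family into one that is no larger.\<close>

lemma least_card_mono:
  assumes "\<F> \<noteq> {}" and "\<And>F. F \<in> \<F> \<Longrightarrow> \<exists>G\<in>\<G>. |G| \<le>o |F|"
  shows "least_card \<G> \<le>o least_card \<F>"
proof -
  obtain F where F: "F \<in> \<F>" "least_card \<F> = |F|"
    using least_card_attained[OF assms(1)] by blast
  obtain G where G: "G \<in> \<G>" "|G| \<le>o |F|"
    using assms(2) F(1) by blast
  then have "least_card \<G> \<le>o |G|"
    using least_card_attained[of \<G>] by fastforce
  then show ?thesis
    using G(2) F(2) ordLeq_transitive by fastforce
qed

text \<open>Only finitely many values are excluded, so guesses can be padded to exactly
  \<open>k\<close> by fresh ones. \<open>X\<close> holds the values that padding must not
  add.\<close>

lemma global_predictor_extend:
  fixes X :: "nat set"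
  assumes "\<And>s. finite (\<rho> s)" and "\<And>s. card (\<rho> s) \<le> k" and "finite X"
  obtains \<pi> where "global_predictor k \<pi>" and "\<And>s. \<rho> s \<subseteq> \<pi> s" and "\<And>s. \<pi> s \<inter> X \<subseteq> \<rho> s"
proof -
  have "\<exists>B. finite B \<and> card B = k \<and> \<rho> s \<subseteq> B \<and> B \<inter> X \<subseteq> \<rho> s" for s
  proof -
    have "infinite (- (\<rho> s \<union> X))"
      using assms by (simp add: Compl_eq_Diff_UNIV)
    then obtain C where C: "finite C" "card C = k - card (\<rho> s)" "C \<subseteq> - (\<rho> s \<union> X)"
      using infinite_arbitrarily_large by blast
    then have "card (\<rho> s \<union> C) = k"
      using assms by (subst card_Un_disjoint) auto
    then show ?thesis
      using C assms(1) by (intro exI[of _ "\<rho> s \<union> C"]) auto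
  qed
  then obtain \<pi> where "\<And>s. finite (\<pi> s) \<and> card (\<pi> s) = k \<and> \<rho> s \<subseteq> \<pi> s \<and> \<pi> s \<inter> X \<subseteq> \<rho> s"
    by metis
  then show thesis
    by (intro that[of \<pi>]) (auto simp: global_predictor_def)
qed

text \<open>Guesses are pulled back along \<open>Suc\<close>; injectivity keeps their number at most
  \<open>k\<close>, and padding restores the width.\<close>

lemma predictor_of_Suc_shift:
  assumes "global_predictor k \<pi>'"
  obtains \<pi> where "global_predictor k \<pi>"
    and "\<And>f. globally_predicts \<pi>' (Suc \<circ> f) \<Longrightarrow> globally_predicts \<pi> f"
proof -
  define \<rho> where "\<rho> s = Suc -` \<pi>' (map Suc s)" for s
  have "finite (\<rho> s)" "card (\<rho> s) \<le> k" for s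
    using assms card_vimage_inj_on_le[of Suc UNIV "\<pi>' (map Suc s)"]
    by (auto simp: \<rho>_def global_predictor_def finite_vimageI)
  then obtain \<pi> where \<pi>: "global_predictor k \<pi>" "\<And>s. \<rho> s \<subseteq> \<pi> s"
    by (rule global_predictor_extend[of \<rho> k "{}"]) (simp, rule that)
  have "globally_predicts \<pi> f" if "globally_predicts \<pi>' (Suc \<circ> f)" for f
    using that unfolding globally_predicts_def
  proof (rule MOST_mono)
    fix n
    assume "(Suc \<circ> f) n \<in> \<pi>' (map (Suc \<circ> f) [0..<n])"
    then have "f n \<in> \<rho> (map f [0..<n])"
      by (simp add: \<rho>_def)
    then show "f n \<in> \<pi> (map f [0..<n])"
      using \<pi>(2) by blast
  qed
  with \<pi>(1) show thesis
    by (rule that)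
qed

text \<open>Used only where a nonzero value at or after \<open>i\<close> exists; otherwise the
  \<open>LEAST\<close> is unspecified.\<close>

definition next_nonzero :: "(nat \<Rightarrow> nat) \<Rightarrow> nat \<Rightarrow> nat" where
  "next_nonzero f i = (LEAST p. i \<le> p \<and> f p \<noteq> 0)"

text \<open>The segment starts at 0 rather than at \<open>i\<close>, so that its entry at position
  \<open>n\<close> is \<open>f n\<close>.\<close>

definition segment_code :: "(nat \<Rightarrow> nat) \<Rightarrow> nat \<Rightarrow> nat" where
  "segment_code f i = list_encode (map f [0..<Suc (next_nonzero f i)])"

text \<open>Completes a finite history to an eventually zero function, so that the notions for
  functions apply to it.\<close>

definition zero_extension :: "nat list \<Rightarrow> nat \<Rightarrow> nat" where
  "zero_extension s i = (if i < length s then s ! i else 0)"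

definition support_bound :: "(nat \<Rightarrow> nat) \<Rightarrow> nat" where
  "support_bound f = (LEAST m. \<forall>p\<ge>m. f p = 0)"

text \<open>These are the codes that \<open>s\<close> already determines: below the support bound,
  the next nonzero value lies within \<open>s\<close>.\<close>

definition segment_history :: "nat list \<Rightarrow> nat list" where
  "segment_history s = map (segment_code (zero_extension s)) [0..<support_bound (zero_extension s)]"

lemma eventually_zero_iff: "f \<in> eventually_zero \<longleftrightarrow> (\<exists>m. \<forall>p\<ge>m. f p = 0)"
  by (simp add: eventually_zero_def MOST_nat_le)

lemma next_nonzero:
  assumes "i \<le> p" "f p \<noteq> 0"
  shows "i \<le> next_nonzero f i" "f (next_nonzero f i) \<noteq> 0" "next_nonzero f i \<le> p"
proof -
  have "i \<le> next_nonzero f i \<and> f (next_nonzero f i) \<noteq> 0"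
    unfolding next_nonzero_def using assms by (intro LeastI[of "\<lambda>p. i \<le> p \<and> f p \<noteq> 0" p]) auto
  then show "i \<le> next_nonzero f i" "f (next_nonzero f i) \<noteq> 0"
    by auto
  show "next_nonzero f i \<le> p"
    unfolding next_nonzero_def using assms by (intro Least_le) auto
qed

text \<open>The code at \<open>i\<close> depends only on the values up to the first nonzero one from
  \<open>i\<close> on, and that one occurs no later than \<open>p\<close>.\<close>

lemma segment_code_cong:
  assumes "i \<le> p" "f p \<noteq> 0" and eq: "\<And>q. q \<le> p \<Longrightarrow> g q = f q"
  shows "segment_code g i = segment_code f i"
proof -
  have gp: "g p \<noteq> 0"
    using assms by simp
  note nf = next_nonzero[of i p f, OF assms(1,2)]
  note ng = next_nonzero[of i p g, OF assms(1) gp]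
  have "next_nonzero g i \<le> next_nonzero f i"
    using nf eq by (intro next_nonzero(3)) auto
  moreover have "next_nonzero f i \<le> next_nonzero g i"
    using ng eq[of "next_nonzero g i"] by (intro next_nonzero(3)) auto
  ultimately have "next_nonzero g i = next_nonzero f i"
    by simp
  then show ?thesis
    unfolding segment_code_def using eq nf(3)
    by (intro arg_cong[of _ _ list_encode] map_cong) auto
qed

lemma zero_extension_restrict: "zero_extension (map f [0..<n]) i = (if i < n then f i else 0)"
  by (simp add: zero_extension_def)

lemma support_bound_zero:
  assumes "f \<in> eventually_zero" "support_bound f \<le> p"
  shows "f p = 0"
proof -
  have "\<forall>p\<ge>support_bound f. f p = 0"
    using assms(1) unfolding support_bound_def eventually_zero_iff by (rule LeastI_ex)
  then show ?thesis
    using assms(2) by blast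
qed

lemma less_support_boundD:
  assumes "i < support_bound f"
  obtains p where "i \<le> p" "f p \<noteq> 0"
proof -
  have "\<not> (\<forall>p\<ge>i. f p = 0)"
    using assms unfolding support_bound_def by (rule not_less_Least)
  then show thesis
    using that by blast
qed

text \<open>A nonzero value of the zero extension sits below \<open>n\<close>, where it agrees with
  \<open>f\<close>. Hence a predictor that sees only \<open>f\<close> below \<open>n\<close> can
  compute a true initial segment of \<open>segment_code f\<close>.\<close>

lemma segment_history_restrict:
  "segment_history (map f [0..<n]) =
     map (segment_code f) [0..<support_bound (zero_extension (map f [0..<n]))]"
proof -
  let ?g = "zero_extension (map f [0..<n])"
  have "segment_code ?g i = segment_code f i" if i: "i < support_bound ?g" for i
  proof -
    obtain p where p: "i \<le> p" "?g p \<noteq> 0"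
      using less_support_boundD[OF i] by blast
    then have "p < n"
      by (metis zero_extension_restrict)
    with p show ?thesis
      by (intro segment_code_cong[of i p]) (auto simp: zero_extension_restrict)
  qed
  then show ?thesis
    by (simp add: segment_history_def)
qed

text \<open>
  The padding of the guesses to width \<open>k\<close> avoids 0; otherwise an eventually zero function could be
  predicted by accident.
\<close>
lemma predictor_of_segment_codes:
  assumes \<pi>': "global_predictor k \<pi>'"
  obtains \<pi> where "global_predictor k \<pi>"
    and "\<And>f. f \<in> eventually_zero \<Longrightarrow> \<not> globally_predicts \<pi> f"
    and "\<And>f. f \<notin> eventually_zero \<Longrightarrow> globally_predicts \<pi>' (segment_code f) \<Longrightarrow> globally_predicts \<pi> f"
proof -
  \<comment> \<open>Each offered code is decoded and read at the current position; segments too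
    short to reach it are discarded, so there may be fewer than \<open>k\<close> guesses.\<close>
  define \<rho> where "\<rho> s = (\<lambda>c. list_decode c ! length s) `
      {c \<in> \<pi>' (segment_history s). length s < length (list_decode c)}" for s
  have fin: "finite (\<pi>' s)" and card: "card (\<pi>' s) = k" for s
    using \<pi>' by (auto simp: global_predictor_def)
  have "finite (\<rho> s)" for s
    using fin by (simp add: \<rho>_def)
  moreover have "card (\<rho> s) \<le> k" for s
  proof -
    have "card (\<rho> s) \<le> card {c \<in> \<pi>' (segment_history s). length s < length (list_decode c)}"
      unfolding \<rho>_def using fin by (intro card_image_le) auto
    also have "\<dots> \<le> card (\<pi>' (segment_history s))"
      using fin by (intro card_mono) auto
    finally show ?thesis
      using card by simp
  qed
  ultimately obtain \<pi> where \<pi>: "global_predictor k \<pi>"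
    and sub: "\<And>s. \<rho> s \<subseteq> \<pi> s" and zero: "\<And>s. \<pi> s \<inter> {0} \<subseteq> \<rho> s"
    by (rule global_predictor_extend[of \<rho> k "{0}"]) (simp, rule that)
  have "\<not> globally_predicts \<pi> f" if ez: "f \<in> eventually_zero" for f
  proof -
    obtain m where m: "\<And>p. m \<le> p \<Longrightarrow> f p = 0"
      using ez by (auto simp: eventually_zero_iff)
    \<comment> \<open>Once all nonzero values of \<open>f\<close> have been seen, the history stays
      equal to \<open>t\<close>, so one finite set of codes serves all later positions.\<close>
    define t where "t = map (segment_code f) [0..<support_bound f]"
    have "finite ((\<lambda>c. length (list_decode c)) ` \<pi>' t)"
      using fin by blast
    then obtain b where b: "\<And>c. c \<in> \<pi>' t \<Longrightarrow> length (list_decode c) \<le> b"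
      unfolding finite_nat_set_iff_bounded_le by blast
    have "f n \<notin> \<pi> (map f [0..<n])" if n: "max m b \<le> n" for n
    proof -
      have "zero_extension (map f [0..<n]) = f"
        using m n by (auto simp: zero_extension_restrict fun_eq_iff)
      then have "segment_history (map f [0..<n]) = t"
        by (simp add: segment_history_def t_def)
      \<comment> \<open>Every segment offered at \<open>t\<close> has length at most
        \<open>b \<le> n\<close>, so none reaches position \<open>n\<close>.\<close>
      then have "\<rho> (map f [0..<n]) = {}"
        using b n by (fastforce simp: \<rho>_def)
      then show ?thesis
        using m[of n] n zero[of "map f [0..<n]"] by auto
    qed
    then have "f (max m' (max m b)) \<notin> \<pi> (map f [0..<max m' (max m b)])" for m'
      by (meson max.cobounded2)
    then show ?thesis
      unfolding globally_predicts_def MOST_nat_le by (metis max.cobounded1)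
  qed
  moreover have "globally_predicts \<pi> f"
    if nz: "f \<notin> eventually_zero" and pred: "globally_predicts \<pi>' (segment_code f)" for f
  proof -
    obtain N where N: "\<And>i. N \<le> i \<Longrightarrow> segment_code f i \<in> \<pi>' (map (segment_code f) [0..<i])"
      using pred by (auto simp: globally_predicts_def MOST_nat_le)
    \<comment> \<open>Once the nonzero value at \<open>p\<close> has been seen, the history has
      length greater than \<open>p \<ge> N\<close>, where \<open>\<pi>'\<close> is already
      correct.\<close>
    obtain p where p: "N \<le> p" "f p \<noteq> 0"
      using nz by (auto simp: eventually_zero_iff)
    have "f n \<in> \<pi> (map f [0..<n])" if n: "p < n" for n
    proof -
      define g where "g = zero_extension (map f [0..<n])"
      \<comment> \<open>One past the last nonzero value of \<open>f\<close> below \<open>n\<close>,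
        which is also the length of the history.\<close>
      define i where "i = support_bound g"
      have g: "g q = (if q < n then f q else 0)" for q
        by (simp add: g_def zero_extension_restrict)
      have "g \<in> eventually_zero"
        unfolding eventually_zero_iff by (intro exI[of _ n]) (simp add: g)
      then have gz: "g q = 0" if "i \<le> q" for q
        using that unfolding i_def by (rule support_bound_zero)
      have "g p \<noteq> 0"
        using p n by (simp add: g)
      with gz have "N \<le> i"
        using p(1) by (meson le_trans linear)
      then have mem: "segment_code f i \<in> \<pi>' (segment_history (map f [0..<n]))"
        using N by (simp add: segment_history_restrict i_def g_def)
      obtain q where "i \<le> q" "f q \<noteq> 0"
        using nz by (auto simp: eventually_zero_iff)
      note e = next_nonzero[of i q f, OF this]
      \<comment> \<open>\<open>f\<close> vanishes from \<open>i\<close> up to \<open>n - 1\<close>,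
        so the segment coded at \<open>i\<close> extends at least to position
        \<open>n\<close>.\<close>
      have "n \<le> next_nonzero f i"
        using gz[OF e(1)] e(2) by (auto simp: g split: if_splits)
      then have "f n \<in> \<rho> (map f [0..<n])"
        unfolding \<rho>_def using mem
        by (intro image_eqI[of _ _ "segment_code f i"])
          (auto simp: segment_code_def nth_append simp del: upt_Suc)
      then show ?thesis
        using sub by blast
    qed
    then show ?thesis
      unfolding globally_predicts_def MOST_nat by blast
  qed
  ultimately show thesis
    by (rule that[OF \<pi>])
qed

theorem theorem2:
  fixes k :: nat
  assumes "k \<ge> 1"
  shows "eG_zero k =o eG k"
proof -
  define \<F> where "\<F> = {F. \<not> (\<exists>\<pi>. global_predictor k \<pi> \<and> (\<forall>f\<in>F. globally_predicts \<pi> f))}"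
  define \<G> where "\<G> = {F. \<not> (\<exists>\<pi>. global_predictor k \<pi> \<and> (\<forall>f\<in>F. zero_globally_predicts \<pi> f))}"
  have "least_card \<G> \<le>o least_card \<F>"
  proof (rule least_card_mono)
    show "\<F> \<noteq> {}"
      using eG_family_exists unfolding \<F>_def by blast
    fix F assume F: "F \<in> \<F>"
    have "Suc \<circ> f \<notin> eventually_zero" for f
      by (auto simp: eventually_zero_iff)
    then have pred_iff: "zero_globally_predicts \<pi> (Suc \<circ> f) \<longleftrightarrow> globally_predicts \<pi> (Suc \<circ> f)" for \<pi> f
      by (simp add: zero_globally_predicts_def)
    have "(\<lambda>f. Suc \<circ> f) ` F \<in> \<G>"
    proof (rule ccontr)
      assume "(\<lambda>f. Suc \<circ> f) ` F \<notin> \<G>"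
      then obtain \<pi>' where \<pi>': "global_predictor k \<pi>'"
        "\<And>f. f \<in> F \<Longrightarrow> globally_predicts \<pi>' (Suc \<circ> f)"
        unfolding \<G>_def by (auto simp: pred_iff)
      obtain \<pi> where "global_predictor k \<pi>"
        "\<And>f. globally_predicts \<pi>' (Suc \<circ> f) \<Longrightarrow> globally_predicts \<pi> f"
        by (rule predictor_of_Suc_shift[OF \<pi>'(1)]) (rule that)
      with F \<pi>'(2) show False
        unfolding \<F>_def by blast
    qed
    then show "\<exists>G\<in>\<G>. |G| \<le>o |F|"
      using card_of_image by blast
  qed
  moreover have "least_card \<F> \<le>o least_card \<G>"
  proof (rule least_card_mono)
    show "\<G> \<noteq> {}"
      using eG_zero_family_exists unfolding \<G>_def by blast
    fix G assume G: "G \<in> \<G>"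
    have "segment_code ` (G - eventually_zero) \<in> \<F>"
    proof (rule ccontr)
      assume "segment_code ` (G - eventually_zero) \<notin> \<F>"
      then obtain \<pi>' where \<pi>': "global_predictor k \<pi>'"
        "\<And>f. f \<in> G \<Longrightarrow> f \<notin> eventually_zero \<Longrightarrow> globally_predicts \<pi>' (segment_code f)"
        unfolding \<F>_def by auto
      obtain \<pi> where "global_predictor k \<pi>"
        "\<And>f. f \<in> eventually_zero \<Longrightarrow> \<not> globally_predicts \<pi> f"
        "\<And>f. f \<notin> eventually_zero \<Longrightarrow> globally_predicts \<pi>' (segment_code f) \<Longrightarrow> globally_predicts \<pi> f"
        by (rule predictor_of_segment_codes[OF \<pi>'(1)]) (rule that)
      with G \<pi>'(2) show False
        unfolding \<G>_def zero_globally_predicts_def by blast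
    qed
    moreover have "|segment_code ` (G - eventually_zero)| \<le>o |G|"
      using card_of_image card_of_mono1[of "G - eventually_zero" G] ordLeq_transitive by blast
    ultimately show "\<exists>F\<in>\<F>. |F| \<le>o |G|"
      by blast
  qed
  ultimately show ?thesis
    unfolding eG_def eG_zero_def \<F>_def \<G>_def by (simp add: ordIso_iff_ordLeq)
qed

end
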